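(* Let $\mathfrak{a}=\mathfrak{a}(\mathfrak{g};\kappa,\lambda,s)$ and $\mathfrak{a}'=\mathfrak{a}(\mathfrak{g}';\kappa',\lambda',s')$ be Lie affgebras over $\mathbb{F}$. Then $\mathfrak{a}$ is isomorphic to $\mathfrak{a}'$ (as a Lie affgebra) if and only if there exist a Lie algebra isomorphism $\Psi:\mathfrak{g}\to\mathfrak{g}'$ and an element $q\in\mathfrak{g}$ such that $$\kappa'=\Psi\kappa\Psi^{-1},\qquad \lambda'=\Psi(\lambda-\mathrm{ad}_q)\Psi^{-1},\qquad s'=\Psi(s+q-\kappa(q)).$$
   Context: $\mathbb{F}$ is a field of characteristic different from 2. $\mathrm{ad}_a(b)=[a,b]$. For a Lie algebra $\mathfrak{g}$ over $\mathbb{F}$, linear endomorphisms $\kappa,\lambda$ of $\mathfrak{g}$ satisfying $\lambda([a,b])=[\lambda(a),b]-[a,\kappa(b)]+[a,\lambda(b)]$ for all $a,b\in\mathfrak{g}$, and $s\in\mathfrak{g}$, the symbol $\mathfrak{a}(\mathfrak{g};\kappa,\lambda,s)$ denotes the Lie affgebra which is the vector space $\mathfrak{g}$ viewed as an affine space ($\langle a,b,c\rangle=a-b+c$, $\alpha\triangleright_a b=(1-\alpha)a+\alpha b$) with the affine Lie bracket $\{a,b\}=[a,b]+\kappa(a)+\lambda(b-a)+s$. A homomorphism of Lie affgebras is an affine map (preserving $\langle-,-,-\rangle$ and satisfying $f(\alpha\triangleright_a b)=\alpha\triangleright_{f(a)}f(b)$; between vector spaces this means linear plus constant) such that $f(\{a,b\})=\{f(a),f(b)\}$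 for all $a,b$; an isomorphism is a bijective homomorphism. *)

theory Defs
  imports Complex_Main
begin

locale lie_algebra = vector_space scale
  for scale :: "'f::field \<Rightarrow> 'a::ab_group_add \<Rightarrow> 'a" +
  fixes brk :: "'a \<Rightarrow> 'a \<Rightarrow> 'a"
  assumes linear_left: "Vector_Spaces.linear scale scale (\<lambda>a. brk a b)"
    and linear_right: "Vector_Spaces.linear scale scale (brk a)"
    and alternating: "brk a a = 0"
    and jacobi: "brk a (brk b c) + brk b (brk c a) + brk c (brk a b) = 0"

definition ad :: "('a \<Rightarrow> 'a \<Rightarrow> 'a) \<Rightarrow> 'a \<Rightarrow> 'a \<Rightarrow> 'a"
  where "ad brk a = (\<lambda>b. brk a b)"

definition lie_algebra_iso ::
  "('f::field \<Rightarrow> 'a::ab_group_add \<Rightarrow> 'a) \<Rightarrow> ('a \<Rightarrow> 'a \<Rightarrow> 'a) \<Rightarrow>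
   ('f \<Rightarrow> 'b::ab_group_add \<Rightarrow> 'b) \<Rightarrow> ('b \<Rightarrow> 'b \<Rightarrow> 'b) \<Rightarrow> ('a \<Rightarrow> 'b) \<Rightarrow> bool"
  where "lie_algebra_iso scale brk scale' brk' \<Psi> \<longleftrightarrow>
    Vector_Spaces.linear scale scale' \<Psi> \<and> bij \<Psi> \<and>
    (\<forall>a b. \<Psi> (brk a b) = brk' (\<Psi> a) (\<Psi> b))"

text \<open>
  The operations of a Lie affgebra: the ternary heap operation \<open>\<langle>a, b, c\<rangle>\<close>, the action
  \<open>\<alpha> \<triangleright>\<^sub>a b\<close> (here \<open>act A \<alpha> a b\<close>), and the affine bracket \<open>{a, b}\<close>.
\<close>

record ('f, 'a) affgebra =
  heap :: "'a \<Rightarrow> 'a \<Rightarrow> 'a \<Rightarrow> 'a"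
  act :: "'f \<Rightarrow> 'a \<Rightarrow> 'a \<Rightarrow> 'a"
  aff_brk :: "'a \<Rightarrow> 'a \<Rightarrow> 'a"

definition affgebra_hom ::
  "('f, 'a) affgebra \<Rightarrow> ('f, 'b) affgebra \<Rightarrow> ('a \<Rightarrow> 'b) \<Rightarrow> bool"
  where "affgebra_hom A B f \<longleftrightarrow>
    (\<forall>a b c. f (heap A a b c) = heap B (f a) (f b) (f c)) \<and>
    (\<forall>\<alpha> a b. f (act A \<alpha> a b) = act B \<alpha> (f a) (f b)) \<and>
    (\<forall>a b. f (aff_brk A a b) = aff_brk B (f a) (f b))"

definition affgebra_isomorphic ::
  "('f, 'a) affgebra \<Rightarrow> ('f, 'b) affgebra \<Rightarrow> bool"
  where "affgebra_isomorphic A B \<longleftrightarrow> (\<exists>f. affgebra_hom A B f \<and> bij f)"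

locale lie_affgebra_data = lie_algebra scale brk
  for scale :: "'f::field \<Rightarrow> 'a::ab_group_add \<Rightarrow> 'a" and brk :: "'a \<Rightarrow> 'a \<Rightarrow> 'a" +
  fixes \<kappa> lam :: "'a \<Rightarrow> 'a"
  assumes linear_kappa: "Vector_Spaces.linear scale scale \<kappa>"
    and linear_lam: "Vector_Spaces.linear scale scale lam"
    and lam_brk: "lam (brk a b) = brk (lam a) b - brk a (\<kappa> b) + brk a (lam b)"

text \<open>The Lie affgebra \<open>\<aa>(\<gg>; \<kappa>, \<lambda>, s)\<close>; \<open>lam\<close> stands for \<open>\<lambda>\<close>.\<close>

definition lie_affgebra ::
  "('f::field \<Rightarrow> 'a::ab_group_add \<Rightarrow> 'a) \<Rightarrow> ('a \<Rightarrow> 'a \<Rightarrow> 'a) \<Rightarrow>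
   ('a \<Rightarrow> 'a) \<Rightarrow> ('a \<Rightarrow> 'a) \<Rightarrow> 'a \<Rightarrow> ('f, 'a) affgebra"
  where "lie_affgebra scale brk \<kappa> lam s =
    \<lparr> heap = (\<lambda>a b c. a - b + c),
      act = (\<lambda>\<alpha> a b. scale (1 - \<alpha>) a + scale \<alpha> b),
      aff_brk = (\<lambda>a b. brk a b + \<kappa> a + lam (b - a) + s) \<rparr>"

end

theory Submission
  imports Defs
begin

text \<open>
  An affine map between vector spaces is a linear map \<open>\<Psi>\<close> followed by a translation by a
  constant \<open>c\<close> (\<open>affine_iff_linear_plus_constant\<close>).  For \<open>f = \<Psi> + c\<close> the condition
  \<open>f {a, b} = {f a, f b}\<close> is an identity between polynomial maps in \<open>(a, b)\<close> of degree at most two.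
  Evaluating it successively at \<open>(0, 0)\<close>, \<open>(a, a)\<close> and \<open>(0, b)\<close> isolates its constant term, its
  \<open>\<kappa>\<close>-part and its \<open>\<lambda>\<close>-part; once these are subtracted, what remains says that \<open>\<Psi>\<close> preserves
  the Lie bracket (\<open>affine_bracket_preserved_iff\<close>).

  If \<open>\<Psi>\<close> is bijective, the translation can be moved to the source, \<open>c = \<Psi> q\<close>; conjugating the
  conditions by \<open>\<Psi>\<close> then yields exactly the formulas for \<open>\<kappa>'\<close>, \<open>\<lambda>'\<close> and \<open>s'\<close>.  In other words, the
  parameter \<open>q\<close> is the preimage of the constant by which an isomorphism fails to be linear.
\<close>

text \<open>Taking \<open>0\<close> as base point turns the heap operation into addition and the action
  into scalar multiplication, up to the constant \<open>f 0\<close>.\<close>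

lemma affine_iff_linear_plus_constant:
  fixes scale :: "'f::field \<Rightarrow> 'a::ab_group_add \<Rightarrow> 'a"
    and scale' :: "'f \<Rightarrow> 'b::ab_group_add \<Rightarrow> 'b"
  assumes "vector_space scale" and "vector_space scale'"
  shows "((\<forall>a b c. f (a - b + c) = f a - f b + f c) \<and>
      (\<forall>\<alpha> a b. f (scale (1 - \<alpha>) a + scale \<alpha> b)
         = scale' (1 - \<alpha>) (f a) + scale' \<alpha> (f b)))
    \<longleftrightarrow> (\<exists>\<Psi> c. Vector_Spaces.linear scale scale' \<Psi> \<and> f = (\<lambda>a. \<Psi> a + c))"
    (is "?heap \<and> ?act \<longleftrightarrow> ?affine")
proof
  interpret V: vector_space scale by fact
  interpret W: vector_space scale' by fact
  assume aff: "?heap \<and> ?act"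
  define \<Psi> where "\<Psi> = (\<lambda>a. f a - f 0)"
  have add: "\<Psi> (a + b) = \<Psi> a + \<Psi> b" for a b
    using aff[THEN conjunct1, rule_format, of a 0 b] by (simp add: \<Psi>_def)
  have scl: "\<Psi> (scale \<alpha> b) = scale' \<alpha> (\<Psi> b)" for \<alpha> b
    using aff[THEN conjunct2, rule_format, of \<alpha> 0 b]
    by (simp add: \<Psi>_def W.scale_left_diff_distrib W.scale_right_diff_distrib)
  have "Vector_Spaces.linear scale scale' \<Psi>"
    using assms add scl by (simp add: Vector_Spaces.linear_iff)
  moreover have "f = (\<lambda>a. \<Psi> a + f 0)"
    by (simp add: \<Psi>_def)
  ultimately show ?affine
    by blast
next
  interpret W: vector_space scale' by fact
  assume ?affine
  then obtain \<Psi> c where lin: "Vector_Spaces.linear scale scale' \<Psi>" and f: "f = (\<lambda>a. \<Psi> a + c)"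
    by blast
  interpret \<Psi>: Vector_Spaces.linear scale scale' \<Psi> by fact
  show "?heap \<and> ?act"
    by (simp add: f \<Psi>.add \<Psi>.diff \<Psi>.scale W.scale_right_distrib W.scale_left_diff_distrib)
qed

context lie_algebra
begin

lemma brk_add_left: "brk (a + b) c = brk a c + brk b c"
  using linear_left by (simp add: Vector_Spaces.linear_iff)

lemma brk_add_right: "brk a (b + c) = brk a b + brk a c"
  using linear_right by (simp add: Vector_Spaces.linear_iff)

lemma brk_zero_left: "brk 0 a = 0"
  using brk_add_left[of 0 0 a] by simp

lemma brk_zero_right: "brk a 0 = 0"
  using brk_add_right[of a 0 0] by simp

lemma brk_antisymmetric: "brk a b = - brk b a"
proof -
  have "brk (a + b) (a + b) = brk a a + brk b a + (brk a b + brk b b)"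
    by (simp only: brk_add_left brk_add_right)
  then show ?thesis
    by (simp add: alternating eq_neg_iff_add_eq_0 add.commute)
qed

end

text \<open>
  The translation by \<open>c\<close> contributes \<open>[\<Psi> a, c] + [c, \<Psi> b] = [c, \<Psi> (b - a)]\<close> to the target
  bracket.  Being a function of \<open>b - a\<close>, it is absorbed by \<open>\<lambda>\<close> as an inner derivation and
  disturbs neither \<open>\<kappa>\<close> nor the Lie bracket.
\<close>

lemma affine_bracket_preserved_iff:
  assumes "lie_affgebra_data scale brk \<kappa> lam"
    and "lie_affgebra_data scale' brk' \<kappa>' lam'"
    and "Vector_Spaces.linear scale scale' \<Psi>"
  shows "(\<forall>a b. \<Psi> (brk a b + \<kappa> a + lam (b - a) + s) + c
        = brk' (\<Psi> a + c) (\<Psi> b + c) + \<kappa>' (\<Psi> a + c) + lam' (\<Psi> b + c - (\<Psi> a + c)) + s')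
    \<longleftrightarrow> (\<forall>a b. \<Psi> (brk a b) = brk' (\<Psi> a) (\<Psi> b)) \<and>
        (\<forall>a. \<kappa>' (\<Psi> a) = \<Psi> (\<kappa> a)) \<and>
        (\<forall>a. lam' (\<Psi> a) = \<Psi> (lam a) - brk' c (\<Psi> a)) \<and>
        s' = \<Psi> s + c - \<kappa>' c"
    (is "?bracket \<longleftrightarrow> ?conditions")
proof -
  interpret A: lie_affgebra_data scale brk \<kappa> lam by fact
  interpret B: lie_affgebra_data scale' brk' \<kappa>' lam' by fact
  interpret \<Psi>: Vector_Spaces.linear scale scale' \<Psi> by fact
  interpret \<kappa>: Vector_Spaces.linear scale scale \<kappa> by (rule A.linear_kappa)
  interpret lam: Vector_Spaces.linear scale scale lam by (rule A.linear_lam)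
  interpret \<kappa>': Vector_Spaces.linear scale' scale' \<kappa>' by (rule B.linear_kappa)
  interpret lam': Vector_Spaces.linear scale' scale' lam' by (rule B.linear_lam)
  note expand = \<Psi>.add \<Psi>.diff \<Psi>.zero \<kappa>.zero lam.zero lam.diff \<kappa>'.add lam'.zero lam'.diff
    A.brk_zero_left A.brk_zero_right B.brk_zero_left B.brk_zero_right
    B.brk_add_left B.brk_add_right A.alternating B.alternating
  show ?thesis
  proof
    assume br: ?bracket
    have s': "s' = \<Psi> s + c - \<kappa>' c"
      using br[rule_format, of 0 0] by (simp add: expand algebra_simps)
    have \<kappa>': "\<kappa>' (\<Psi> a) = \<Psi> (\<kappa> a)" for a
      using br[rule_format, of a a] B.brk_antisymmetric[of c "\<Psi> a"]
      by (simp add: s' expand algebra_simps)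
    have lam': "lam' (\<Psi> a) = \<Psi> (lam a) - brk' c (\<Psi> a)" for a
      using br[rule_format, of 0 a] by (simp add: s' expand algebra_simps)
    have "\<Psi> (brk a b) = brk' (\<Psi> a) (\<Psi> b)" for a b
      using br[rule_format, of a b] B.brk_antisymmetric[of c "\<Psi> a"]
      by (simp add: s' \<kappa>' lam' expand algebra_simps)
    with s' \<kappa>' lam' show ?conditions
      by blast
  next
    assume ?conditions
    then have hom: "\<Psi> (brk a b) = brk' (\<Psi> a) (\<Psi> b)"
      and \<kappa>': "\<kappa>' (\<Psi> a) = \<Psi> (\<kappa> a)"
      and lam': "lam' (\<Psi> a) = \<Psi> (lam a) - brk' c (\<Psi> a)"
      and s': "s' = \<Psi> s + c - \<kappa>' c" for a b
      by blast+
    show ?bracket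
    proof (intro allI)
      fix a b
      show "\<Psi> (brk a b + \<kappa> a + lam (b - a) + s) + c
        = brk' (\<Psi> a + c) (\<Psi> b + c) + \<kappa>' (\<Psi> a + c) + lam' (\<Psi> b + c - (\<Psi> a + c)) + s'"
        using B.brk_antisymmetric[of c "\<Psi> a"]
        by (simp add: hom s' \<kappa>' lam' expand algebra_simps)
    qed
  qed
qed

lemma eq_conjugate_iff:
  assumes "bij \<Psi>"
  shows "g = \<Psi> \<circ> h \<circ> inv \<Psi> \<longleftrightarrow> (\<forall>a. g (\<Psi> a) = \<Psi> (h a))"
proof
  show "\<forall>a. g (\<Psi> a) = \<Psi> (h a)" if "g = \<Psi> \<circ> h \<circ> inv \<Psi>"
    using assms that by (simp add: bij_is_inj)
next
  assume eq: "\<forall>a. g (\<Psi> a) = \<Psi> (h a)"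
  show "g = \<Psi> \<circ> h \<circ> inv \<Psi>"
  proof
    fix b
    show "g b = (\<Psi> \<circ> h \<circ> inv \<Psi>) b"
      using eq[rule_format, of "inv \<Psi> b"] assms by (simp add: bij_is_surj surj_f_inv_f)
  qed
qed

lemma bij_plus_constant_iff:
  fixes \<Psi> :: "'a \<Rightarrow> 'b::ab_group_add"
  shows "bij (\<lambda>a. \<Psi> a + c) \<longleftrightarrow> bij \<Psi>"
proof
  show "bij (\<lambda>a. \<Psi> a + c)" if "bij \<Psi>"
    using bij_comp[OF that bij_plus_right[of c]] by (simp add: comp_def)
next
  assume "bij (\<lambda>a. \<Psi> a + c)"
  from bij_comp[OF this bij_plus_right[of "- c"]] show "bij \<Psi>"
    by (simp add: comp_def)
qed

text \<open>
  Writing the constant as \<open>\<Psi> q\<close> puts every condition on \<open>\<Psi> + \<Psi> q\<close> in the form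
  \<open>g \<circ> \<Psi> = \<Psi> \<circ> h\<close>, which for bijective \<open>\<Psi>\<close> determines \<open>g\<close>.  The inner derivation of the target
  given by \<open>\<Psi> q\<close> becomes \<open>ad q\<close> because \<open>\<Psi>\<close> preserves the Lie brackets.
\<close>

lemma translated_iso_iff_conjugate:
  assumes "lie_affgebra_data scale brk \<kappa> lam"
    and "lie_affgebra_data scale' brk' \<kappa>' lam'"
    and lin: "Vector_Spaces.linear scale scale' \<Psi>" and bij: "bij \<Psi>"
  shows "affgebra_hom (lie_affgebra scale brk \<kappa> lam s) (lie_affgebra scale' brk' \<kappa>' lam' s')
      (\<lambda>a. \<Psi> a + \<Psi> q)
    \<longleftrightarrow> lie_algebra_iso scale brk scale' brk' \<Psi> \<and>
      \<kappa>' = \<Psi> \<circ> \<kappa> \<circ> inv \<Psi> \<and>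
      lam' = \<Psi> \<circ> (\<lambda>a. lam a - ad brk q a) \<circ> inv \<Psi> \<and>
      s' = \<Psi> (s + q - \<kappa> q)"
proof -
  interpret A: lie_affgebra_data scale brk \<kappa> lam by fact
  interpret B: lie_affgebra_data scale' brk' \<kappa>' lam' by fact
  interpret \<Psi>: Vector_Spaces.linear scale scale' \<Psi> by fact
  have affine: "(\<forall>a b d. \<Psi> (a - b + d) + \<Psi> q = \<Psi> a + \<Psi> q - (\<Psi> b + \<Psi> q) + (\<Psi> d + \<Psi> q)) \<and>
    (\<forall>\<alpha> a b. \<Psi> (scale (1 - \<alpha>) a + scale \<alpha> b) + \<Psi> q
      = scale' (1 - \<alpha>) (\<Psi> a + \<Psi> q) + scale' \<alpha> (\<Psi> b + \<Psi> q))"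
    using affine_iff_linear_plus_constant
      [OF A.vector_space_axioms B.vector_space_axioms, of "\<lambda>a. \<Psi> a + \<Psi> q"] lin
    by blast
  have "affgebra_hom (lie_affgebra scale brk \<kappa> lam s) (lie_affgebra scale' brk' \<kappa>' lam' s')
      (\<lambda>a. \<Psi> a + \<Psi> q)
    \<longleftrightarrow> (\<forall>a b. \<Psi> (brk a b + \<kappa> a + lam (b - a) + s) + \<Psi> q
        = brk' (\<Psi> a + \<Psi> q) (\<Psi> b + \<Psi> q) + \<kappa>' (\<Psi> a + \<Psi> q)
          + lam' (\<Psi> b + \<Psi> q - (\<Psi> a + \<Psi> q)) + s')"
    unfolding affgebra_hom_def lie_affgebra_def affgebra.simps using affine by blast
  also have "\<dots> \<longleftrightarrow> (\<forall>a b. \<Psi> (brk a b) = brk' (\<Psi> a) (\<Psi> b)) \<and>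
        (\<forall>a. \<kappa>' (\<Psi> a) = \<Psi> (\<kappa> a)) \<and>
        (\<forall>a. lam' (\<Psi> a) = \<Psi> (lam a) - brk' (\<Psi> q) (\<Psi> a)) \<and>
        s' = \<Psi> s + \<Psi> q - \<kappa>' (\<Psi> q)"
    by (rule affine_bracket_preserved_iff[OF assms(1-3)])
  also have "\<dots> \<longleftrightarrow> (\<forall>a b. \<Psi> (brk a b) = brk' (\<Psi> a) (\<Psi> b)) \<and>
        (\<forall>a. \<kappa>' (\<Psi> a) = \<Psi> (\<kappa> a)) \<and>
        (\<forall>a. lam' (\<Psi> a) = \<Psi> (lam a - ad brk q a)) \<and>
        s' = \<Psi> (s + q - \<kappa> q)"
    by (auto simp: ad_def \<Psi>.add \<Psi>.diff)
  finally show ?thesis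
    by (simp add: eq_conjugate_iff[OF bij] lie_algebra_iso_def lin bij)
qed

theorem corollary3p5:
  fixes scale :: "'f::field \<Rightarrow> 'a::ab_group_add \<Rightarrow> 'a"
    and scale' :: "'f \<Rightarrow> 'b::ab_group_add \<Rightarrow> 'b"
    and brk :: "'a \<Rightarrow> 'a \<Rightarrow> 'a" and brk' :: "'b \<Rightarrow> 'b \<Rightarrow> 'b"
    and \<kappa> lam :: "'a \<Rightarrow> 'a" and \<kappa>' lam' :: "'b \<Rightarrow> 'b"
    and s :: 'a and s' :: 'b
  assumes "CHAR('f) \<noteq> 2"
    and "lie_affgebra_data scale brk \<kappa> lam"
    and "lie_affgebra_data scale' brk' \<kappa>' lam'"
  shows "affgebra_isomorphic (lie_affgebra scale brk \<kappa> lam s)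
                             (lie_affgebra scale' brk' \<kappa>' lam' s') \<longleftrightarrow>
    (\<exists>\<Psi> q. lie_algebra_iso scale brk scale' brk' \<Psi> \<and>
      \<kappa>' = \<Psi> \<circ> \<kappa> \<circ> inv \<Psi> \<and>
      lam' = \<Psi> \<circ> (\<lambda>a. lam a - ad brk q a) \<circ> inv \<Psi> \<and>
      s' = \<Psi> (s + q - \<kappa> q))"
proof -
  interpret A: lie_affgebra_data scale brk \<kappa> lam by fact
  interpret B: lie_affgebra_data scale' brk' \<kappa>' lam' by fact
  let ?A = "lie_affgebra scale brk \<kappa> lam s" and ?B = "lie_affgebra scale' brk' \<kappa>' lam' s'"
  note conjugate = translated_iso_iff_conjugate[OF assms(2,3)]
  show ?thesis
  proof
    assume "affgebra_isomorphic ?A ?B"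
    then obtain f where hom: "affgebra_hom ?A ?B f" and "bij f"
      by (auto simp: affgebra_isomorphic_def)
    from hom obtain \<Psi> c where lin: "Vector_Spaces.linear scale scale' \<Psi>"
      and f: "f = (\<lambda>a. \<Psi> a + c)"
      using affine_iff_linear_plus_constant
        [OF A.vector_space_axioms B.vector_space_axioms, of f]
      unfolding affgebra_hom_def lie_affgebra_def affgebra.simps by blast
    from \<open>bij f\<close> have bij: "bij \<Psi>"
      by (simp add: f bij_plus_constant_iff)
    then obtain q where "c = \<Psi> q"
      by (meson bij_pointE)
    with hom conjugate[OF lin bij] show "\<exists>\<Psi> q. lie_algebra_iso scale brk scale' brk' \<Psi> \<and>
      \<kappa>' = \<Psi> \<circ> \<kappa> \<circ> inv \<Psi> \<and>
      lam' = \<Psi> \<circ> (\<lambda>a. lam a - ad brk q a) \<circ> inv \<Psi> \<and>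
      s' = \<Psi> (s + q - \<kappa> q)"
      unfolding f by blast
  next
    assume "\<exists>\<Psi> q. lie_algebra_iso scale brk scale' brk' \<Psi> \<and>
      \<kappa>' = \<Psi> \<circ> \<kappa> \<circ> inv \<Psi> \<and>
      lam' = \<Psi> \<circ> (\<lambda>a. lam a - ad brk q a) \<circ> inv \<Psi> \<and>
      s' = \<Psi> (s + q - \<kappa> q)"
    then obtain \<Psi> q where iso: "lie_algebra_iso scale brk scale' brk' \<Psi>"
      and conj: "\<kappa>' = \<Psi> \<circ> \<kappa> \<circ> inv \<Psi>"
        "lam' = \<Psi> \<circ> (\<lambda>a. lam a - ad brk q a) \<circ> inv \<Psi>" "s' = \<Psi> (s + q - \<kappa> q)"
      by blast
    from iso have lin: "Vector_Spaces.linear scale scale' \<Psi>" and bij: "bij \<Psi>"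
      by (simp_all add: lie_algebra_iso_def)
    have "affgebra_hom ?A ?B (\<lambda>a. \<Psi> a + \<Psi> q)"
      using conjugate[OF lin bij] iso conj by blast
    moreover have "bij (\<lambda>a. \<Psi> a + \<Psi> q)"
      by (simp add: bij_plus_constant_iff bij)
    ultimately show "affgebra_isomorphic ?A ?B"
      by (auto simp: affgebra_isomorphic_def)
  qed
qed

end
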